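(* For the downlink pinching-antenna system with $N>1$ pinching antennas, $$\mathcal R_{\mathrm M,\mathrm T}^{\mathrm D}\subseteq\mathcal R_{\mathrm M,\mathrm F}^{\mathrm D}\subseteq\mathcal C_{\mathrm M}^{\mathrm D}\subseteq\mathcal C_{\mathrm M,\mathrm{OB}}^{\mathrm D}.$$
   Context: Setting. Let $N>1$ be an integer; $\eta,\sigma^2,d,k_0,\lambda_{\mathrm g},\Delta,P>0$; $y_{\mathrm p}\in\mathbb R$; users at $[x_k,y_k,0]^{\mathsf T}$, $k=1,2$, with $x_1\le x_2$ and $[x_1,x_2]\subseteq[q_0,q_{\max}]$. Put $d_k^2=d^2+(y_k-y_{\mathrm p})^2$. The feasible set is $\mathcal P=\{\mathbf q=(q_1,\dots,q_N)\in[q_0,q_{\max}]^N:|q_n-q_{n'}|\ge\Delta\ \forall n\ne n'\}$, assumed nonempty. The effective channel of user $k$ is $$h_k(\mathbf q)=\frac1{\sqrt N}\sum_{n=1}^N\frac{\sqrt\eta\,e^{-\mathrm jk_0\sqrt{d_k^2+(x_k-q_n)^2}}}{\sqrt{d_k^2+(x_k-q_n)^2}}\,e^{-\mathrm j2\pi|q_n-q_0|/\lambda_{\mathrm g}}.$$ Let $\mathbf q_k^\diamond\in\arg\max_{\mathbf q\in\mathcal P}|h_k(\mathbf q)|^2$. $\mathrm{Conv}$ denotes the convex hull. For uplink powers $P_1,P_2\ge0$ let $r_k^{\mathrm U}(\mathbf q)=\log_2(1+P_k|h_k(\mathbf q)|^2/\sigma^2)$, $r_{1,2}^{\mathrm U}(\mathbf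 q)=\log_2(1+(P_1|h_1(\mathbf q)|^2+P_2|h_2(\mathbf q)|^2)/\sigma^2)$, and define the (dual) uplink regions: $\mathcal C_{\mathrm M}^{\mathrm U}=\mathrm{Conv}(\bigcup_{\mathbf q\in\mathcal P}\{(R_1,R_2):0\le R_k\le r_k^{\mathrm U}(\mathbf q),\ k=1,2,\ R_1+R_2\le r_{1,2}^{\mathrm U}(\mathbf q)\})$; $\mathcal R_{\mathrm M,\mathrm T}^{\mathrm U}=\bigcup_{\rho\in[0,1]}\{(R_1,R_2):0\le R_1\le\rho\,r_1^{\mathrm U}(\mathbf q_1^\diamond),\ 0\le R_2\le(1-\rho)\,r_2^{\mathrm U}(\mathbf q_2^\diamond)\}$; $\mathcal R_{\mathrm M,\mathrm F}^{\mathrm U}=\mathrm{Conv}(\bigcup_{\mathbf q\in\mathcal P}\bigcup_{\rho\in[0,1]}\{(R_1,R_2):0\le R_k\le R_k^\rho(\mathbf q),\ k=1,2\})$ with $R_1^\rho(\mathbf q)=\rho\log_2(1+\frac{P_1|h_1(\mathbf q)|^2}{\rho\sigma^2})$, $R_2^\rho(\mathbf q)=(1-\rho)\log_2(1+\frac{P_2|h_2(\mathbf q)|^2}{(1-\rho)\sigma^2})$, $R_1^0\equiv0$, $R_2^1\equiv0$; $\mathcal C_{\mathrm M,\mathrm{OB}}^{\mathrm U}=\{(R_1,R_2):0\le R_k\le r_k^{\mathrm U}(\mathbf q_k^\diamond),\ k=1,2,\ R_1+R_2\le r_\diamond^{\mathrm U}\}$, where $f_\diamond(x)=\frac{P_1\eta/\sigma^2}{d_1^2+(x-x_1)^2}+\frac{P_2\eta/\sigma^2}{d_2^2+(x-x_2)^2}$,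 $\mathcal X_\diamond$ is the set of critical points (zeros of the derivative) of $f_\diamond$ in $[x_1,x_2]$, and $r_\diamond^{\mathrm U}=\log_2(1+N\max_{x\in\mathcal X_\diamond\cup\{x_1,x_2\}}f_\diamond(x))$. The downlink regions with total power $P$ are, via uplink-downlink duality, $\mathcal C_{\mathrm M}^{\mathrm D}$, $\mathcal R_{\mathrm M,\mathrm T}^{\mathrm D}$, $\mathcal R_{\mathrm M,\mathrm F}^{\mathrm D}$, $\mathcal C_{\mathrm M,\mathrm{OB}}^{\mathrm D}$, each defined as $\mathrm{Conv}(\bigcup_{P_1+P_2=P}\,\cdot\,)$ of the corresponding uplink region $\mathcal C_{\mathrm M}^{\mathrm U}$, $\mathcal R_{\mathrm M,\mathrm T}^{\mathrm U}$, $\mathcal R_{\mathrm M,\mathrm F}^{\mathrm U}$, $\mathcal C_{\mathrm M,\mathrm{OB}}^{\mathrm U}$, the union being over all $P_1,P_2\ge0$ with $P_1+P_2=P$. *)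

theory Defs
  imports "HOL-Analysis.Analysis"
begin

(* Users are indexed by k = 1, 2; the values of user_x and user_y at other indices are irrelevant. *)
record pinching_system =
  num_ant :: nat
  eta :: real
  noise_var :: real      (* sigma^2 *)
  height :: real         (* d *)
  wave_num :: real       (* k_0 *)
  guide_len :: real      (* lambda_g *)
  spacing :: real        (* Delta *)
  guide_y :: real        (* y_p *)
  feed_pos :: real       (* q_0 *)
  end_pos :: real        (* q_max *)
  user_x :: "nat \<Rightarrow> real"
  user_y :: "nat \<Rightarrow> real"

(* d_k^2 *)
definition user_dist_sq :: "pinching_system \<Rightarrow> nat \<Rightarrow> real" where
  "user_dist_sq S k = (height S)\<^sup>2 + (user_y S k - guide_y S)\<^sup>2"

(* N-tuples are extensional functions on {1..N}. *)
definition feasible :: "pinching_system \<Rightarrow> (nat \<Rightarrow> real) set" where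
  "feasible S =
    {q \<in> {1..num_ant S} \<rightarrow>\<^sub>E {feed_pos S..end_pos S}.
       \<forall>n\<in>{1..num_ant S}. \<forall>n'\<in>{1..num_ant S}. n \<noteq> n' \<longrightarrow> \<bar>q n - q n'\<bar> \<ge> spacing S}"

definition channel :: "pinching_system \<Rightarrow> nat \<Rightarrow> (nat \<Rightarrow> real) \<Rightarrow> complex" where
  "channel S k q =
    complex_of_real (1 / sqrt (real (num_ant S))) *
    (\<Sum>n=1..num_ant S.
       complex_of_real (sqrt (eta S)) *
       exp (- \<i> * complex_of_real (wave_num S * sqrt (user_dist_sq S k + (user_x S k - q n)\<^sup>2)))
       / complex_of_real (sqrt (user_dist_sq S k + (user_x S k - q n)\<^sup>2))
       * exp (- \<i> * complex_of_real (2 * pi * \<bar>q n - feed_pos S\<bar> / guide_len S)))"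

definition channel_gain :: "pinching_system \<Rightarrow> nat \<Rightarrow> (nat \<Rightarrow> real) \<Rightarrow> real" where
  "channel_gain S k q = (cmod (channel S k q))\<^sup>2"

definition best_placement :: "pinching_system \<Rightarrow> nat \<Rightarrow> (nat \<Rightarrow> real) \<Rightarrow> bool" where
  "best_placement S k q \<longleftrightarrow> is_arg_max (channel_gain S k) (\<lambda>q. q \<in> feasible S) q"

(* r_k^U, where Pk is the power of user k *)
definition user_rate :: "pinching_system \<Rightarrow> real \<Rightarrow> nat \<Rightarrow> (nat \<Rightarrow> real) \<Rightarrow> real" where
  "user_rate S Pk k q = log 2 (1 + Pk * channel_gain S k q / noise_var S)"

definition sum_rate :: "pinching_system \<Rightarrow> real \<Rightarrow> real \<Rightarrow> (nat \<Rightarrow> real) \<Rightarrow> real" where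
  "sum_rate S P1 P2 q =
    log 2 (1 + (P1 * channel_gain S 1 q + P2 * channel_gain S 2 q) / noise_var S)"

definition capacity_uplink :: "pinching_system \<Rightarrow> real \<Rightarrow> real \<Rightarrow> (real \<times> real) set" where
  "capacity_uplink S P1 P2 = convex hull (\<Union>q\<in>feasible S.
    {(R1, R2). 0 \<le> R1 \<and> R1 \<le> user_rate S P1 1 q \<and> 0 \<le> R2 \<and> R2 \<le> user_rate S P2 2 q \<and>
               R1 + R2 \<le> sum_rate S P1 P2 q})"

(* The placements qs1 and qs2 stand for the maximisers of the gains of users 1 and 2. *)
definition tdma_uplink ::
    "pinching_system \<Rightarrow> (nat \<Rightarrow> real) \<Rightarrow> (nat \<Rightarrow> real) \<Rightarrow> real \<Rightarrow> real \<Rightarrow> (real \<times> real) set" where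
  "tdma_uplink S qs1 qs2 P1 P2 = (\<Union>\<rho>\<in>{0..1}.
    {(R1, R2). 0 \<le> R1 \<and> R1 \<le> \<rho> * user_rate S P1 1 qs1 \<and>
               0 \<le> R2 \<and> R2 \<le> (1 - \<rho>) * user_rate S P2 2 qs2})"

(* The rate of user k on a bandwidth fraction b: b = \<rho> for user 1 and b = 1 - \<rho> for user 2. *)
definition fdma_rate ::
    "pinching_system \<Rightarrow> real \<Rightarrow> nat \<Rightarrow> real \<Rightarrow> (nat \<Rightarrow> real) \<Rightarrow> real" where
  "fdma_rate S Pk k b q =
    (if b = 0 then 0 else b * log 2 (1 + Pk * channel_gain S k q / (b * noise_var S)))"

definition fdma_uplink :: "pinching_system \<Rightarrow> real \<Rightarrow> real \<Rightarrow> (real \<times> real) set" where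
  "fdma_uplink S P1 P2 = convex hull (\<Union>q\<in>feasible S. \<Union>\<rho>\<in>{0..1}.
    {(R1, R2). 0 \<le> R1 \<and> R1 \<le> fdma_rate S P1 1 \<rho> q \<and>
               0 \<le> R2 \<and> R2 \<le> fdma_rate S P2 2 (1 - \<rho>) q})"

definition outer_fun :: "pinching_system \<Rightarrow> real \<Rightarrow> real \<Rightarrow> real \<Rightarrow> real" where
  "outer_fun S P1 P2 x =
    (P1 * eta S / noise_var S) / (user_dist_sq S 1 + (x - user_x S 1)\<^sup>2) +
    (P2 * eta S / noise_var S) / (user_dist_sq S 2 + (x - user_x S 2)\<^sup>2)"

definition outer_crit :: "pinching_system \<Rightarrow> real \<Rightarrow> real \<Rightarrow> real set" where
  "outer_crit S P1 P2 = {x \<in> {user_x S 1..user_x S 2}. deriv (outer_fun S P1 P2) x = 0}"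

(* Greatest is used because Max is unspecified on infinite sets and finiteness of the
   set of critical points is not part of the definition. The maximum exists for positive
   height: the candidate set is compact and nonempty, and the function is continuous. *)
definition outer_sum_rate :: "pinching_system \<Rightarrow> real \<Rightarrow> real \<Rightarrow> real" where
  "outer_sum_rate S P1 P2 =
    log 2 (1 + real (num_ant S) *
      (GREATEST v. v \<in> outer_fun S P1 P2 ` (outer_crit S P1 P2 \<union> {user_x S 1, user_x S 2})))"

definition outer_uplink ::
    "pinching_system \<Rightarrow> (nat \<Rightarrow> real) \<Rightarrow> (nat \<Rightarrow> real) \<Rightarrow> real \<Rightarrow> real \<Rightarrow> (real \<times> real) set" where
  "outer_uplink S qs1 qs2 P1 P2 =
    {(R1, R2). 0 \<le> R1 \<and> R1 \<le> user_rate S P1 1 qs1 \<and> 0 \<le> R2 \<and> R2 \<le> user_rate S P2 2 qs2 \<and>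
               R1 + R2 \<le> outer_sum_rate S P1 P2}"

definition downlink ::
    "(real \<Rightarrow> real \<Rightarrow> (real \<times> real) set) \<Rightarrow> real \<Rightarrow> (real \<times> real) set" where
  "downlink U P = convex hull (\<Union>{U P1 P2 | P1 P2. 0 \<le> P1 \<and> 0 \<le> P2 \<and> P1 + P2 = P})"

end

theory Submission
  imports Defs
begin

text \<open>
  Each inclusion holds already for the uplink regions at every fixed power split, and the downlink
  construction is monotone. Time sharing between the two users is a convex combination of the two
  extreme bandwidth splits. Frequency division lies below the capacity region because the
  logarithm is concave. For the outer bound, the triangle inequality and Cauchy--Schwarz bound the
  channel gain by the sum of the squared amplitudes; the weighted sum of the gains is thus at most
  the sum of the outer function over the antenna positions. This function is increasing left of
  both users and decreasing right of both, so its global maximum over the line is attained between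
  the users, either at a user or at a critical point.
\<close>

lemma downlink_mono:
  assumes "\<And>P1 P2. 0 \<le> P1 \<Longrightarrow> 0 \<le> P2 \<Longrightarrow> U P1 P2 \<subseteq> V P1 P2"
  shows "downlink U P \<subseteq> downlink V P"
  unfolding downlink_def by (rule hull_mono) (use assms in blast)

lemma channel_gain_nonneg: "0 \<le> channel_gain S k q"
  by (simp add: channel_gain_def)

section \<open>Time division inside frequency division\<close>

lemma tdma_uplink_subset_fdma_uplink:
  assumes q1: "qs1 \<in> feasible S" and q2: "qs2 \<in> feasible S"
    and pos: "0 \<le> P1" "0 \<le> P2" "0 < noise_var S"
  shows "tdma_uplink S qs1 qs2 P1 P2 \<subseteq> fdma_uplink S P1 P2"
proof
  fix R assume "R \<in> tdma_uplink S qs1 qs2 P1 P2"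
  then obtain \<rho> R1 R2 where R: "R = (R1, R2)" and \<rho>: "0 \<le> \<rho>" "\<rho> \<le> 1"
    and R1: "0 \<le> R1" "R1 \<le> \<rho> * user_rate S P1 1 qs1"
    and R2: "0 \<le> R2" "R2 \<le> (1 - \<rho>) * user_rate S P2 2 qs2"
    by (auto simp: tdma_uplink_def)
  let ?F = "\<Union>q\<in>feasible S. \<Union>\<rho>\<in>{0..1}.
    {(R1, R2). 0 \<le> R1 \<and> R1 \<le> fdma_rate S P1 1 \<rho> q \<and>
               0 \<le> R2 \<and> R2 \<le> fdma_rate S P2 2 (1 - \<rho>) q}"
  have nonneg: "0 \<le> user_rate S P1 1 qs1" "0 \<le> user_rate S P2 2 qs2"
    using pos by (auto simp: user_rate_def channel_gain_nonneg zero_le_log_cancel_iff add_pos_nonneg)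
  \<comment> \<open>With the whole band given to one user, \<open>fdma_rate\<close> equals
    \<open>user_rate\<close> for that user and is 0 for the other by its case split. The union
    ranges over all placements, so the two users may use different ones, \<open>qs1\<close> and
    \<open>qs2\<close>.\<close>
  have one: "(r, 0) \<in> ?F" if "0 \<le> r" "r \<le> user_rate S P1 1 qs1" for r
    using that q1 by (intro UN_I[of qs1] UN_I[of 1]) (auto simp: fdma_rate_def user_rate_def)
  have two: "(0, r) \<in> ?F" if "0 \<le> r" "r \<le> user_rate S P2 2 qs2" for r
    using that q2 by (intro UN_I[of qs2] UN_I[of 0]) (auto simp: fdma_rate_def user_rate_def)
  \<comment> \<open>Dividing by the share makes the weights of the convex combination restore
    \<open>R1\<close> and \<open>R2\<close>. When a share is 0, the corresponding rate is 0 as well,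
    the quotient is 0 by convention, and \<open>nonneg\<close> keeps it admissible.\<close>
  have "(R1 / \<rho>, 0) \<in> convex hull ?F"
    using R1 \<rho> nonneg(1)
    by (intro hull_inc one) (cases "\<rho> = 0"; simp add: divide_simps mult.commute)+
  moreover have "(0, R2 / (1 - \<rho>)) \<in> convex hull ?F"
    using R2 \<rho> nonneg(2)
    by (intro hull_inc two) (cases "\<rho> = 1"; simp add: divide_simps mult.commute)+
  ultimately have "\<rho> *\<^sub>R (R1 / \<rho>, 0) + (1 - \<rho>) *\<^sub>R (0, R2 / (1 - \<rho>)) \<in> convex hull ?F"
    using \<rho> by (intro convexD[OF convex_convex_hull]) auto
  moreover have "\<rho> *\<^sub>R (R1 / \<rho>, 0) + (1 - \<rho>) *\<^sub>R (0, R2 / (1 - \<rho>)) = R"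
    using R R1 R2 by auto
  ultimately show "R \<in> fdma_uplink S P1 P2"
    by (simp only: fdma_uplink_def)
qed

section \<open>Frequency division inside the capacity region\<close>

lemma share_log_add_le:
  fixes a b \<rho> :: real
  assumes "0 \<le> a" "0 \<le> b" "0 \<le> \<rho>" "\<rho> \<le> 1"
  shows "(if \<rho> = 0 then 0 else \<rho> * log 2 (1 + a / \<rho>)) +
    (if 1 - \<rho> = 0 then 0 else (1 - \<rho>) * log 2 (1 + b / (1 - \<rho>))) \<le> log 2 (1 + a + b)"
proof -
  consider "\<rho> = 0" | "\<rho> = 1" | "0 < \<rho>" "\<rho> < 1"
    using assms by linarith
  then show ?thesis
  proof cases
    case 3
    \<comment> \<open>Jensen's inequality: the shares serve as weights and cancel against the
      denominators, so the mean of the two arguments is \<open>1 + a + b\<close>.\<close>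
    have "- log 2 ((1 - \<rho>) *\<^sub>R (1 + b / (1 - \<rho>)) + \<rho> *\<^sub>R (1 + a / \<rho>))
      \<le> (1 - \<rho>) * - log 2 (1 + b / (1 - \<rho>)) + \<rho> * - log 2 (1 + a / \<rho>)"
      using 3 assms by (intro convex_onD[OF minus_log_convex]) (auto intro: add_pos_nonneg)
    moreover have "(1 - \<rho>) *\<^sub>R (1 + b / (1 - \<rho>)) + \<rho> *\<^sub>R (1 + a / \<rho>) = 1 + a + b"
      using 3 by (simp add: distrib_left)
    ultimately show ?thesis
      using 3 by simp
  qed (use assms in auto)
qed

text \<open>With \<open>b = 0\<close> the second user contributes \<open>log 2 1 = 0\<close> to the
  sum bound.\<close>

lemma share_log_le:
  fixes a \<rho> :: real
  assumes "0 \<le> a" "0 \<le> \<rho>" "\<rho> \<le> 1"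
  shows "(if \<rho> = 0 then 0 else \<rho> * log 2 (1 + a / \<rho>)) \<le> log 2 (1 + a)"
  using share_log_add_le[of a 0 \<rho>] assms by (auto split: if_splits)

lemma fdma_uplink_subset_capacity_uplink:
  assumes pos: "0 \<le> P1" "0 \<le> P2" "0 < noise_var S"
  shows "fdma_uplink S P1 P2 \<subseteq> capacity_uplink S P1 P2"
proof -
  have bounds: "fdma_rate S P1 1 \<rho> q \<le> user_rate S P1 1 q"
    "fdma_rate S P2 2 (1 - \<rho>) q \<le> user_rate S P2 2 q"
    "fdma_rate S P1 1 \<rho> q + fdma_rate S P2 2 (1 - \<rho>) q \<le> sum_rate S P1 P2 q"
    if \<rho>: "0 \<le> \<rho>" "\<rho> \<le> 1" for \<rho> q
  proof -
    \<comment> \<open>The full-band signal-to-noise ratios. Noise power scales with bandwidth, so on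
      a share they are divided by that share.\<close>
    define a where "a = P1 * channel_gain S 1 q / noise_var S"
    define b where "b = P2 * channel_gain S 2 q / noise_var S"
    have ab: "0 \<le> a" "0 \<le> b"
      using pos by (auto simp: a_def b_def channel_gain_nonneg)
    have 1: "fdma_rate S P1 1 \<rho> q = (if \<rho> = 0 then 0 else \<rho> * log 2 (1 + a / \<rho>))"
      by (simp add: fdma_rate_def a_def mult.commute)
    have 2: "fdma_rate S P2 2 (1 - \<rho>) q =
        (if 1 - \<rho> = 0 then 0 else (1 - \<rho>) * log 2 (1 + b / (1 - \<rho>)))"
      by (simp add: fdma_rate_def b_def mult.commute)
    have 3: "user_rate S P1 1 q = log 2 (1 + a)" "user_rate S P2 2 q = log 2 (1 + b)"
        "sum_rate S P1 P2 q = log 2 (1 + a + b)"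
      by (simp_all add: user_rate_def sum_rate_def a_def b_def add_divide_distrib add.assoc)
    show "fdma_rate S P1 1 \<rho> q \<le> user_rate S P1 1 q"
      "fdma_rate S P2 2 (1 - \<rho>) q \<le> user_rate S P2 2 q"
      "fdma_rate S P1 1 \<rho> q + fdma_rate S P2 2 (1 - \<rho>) q \<le> sum_rate S P1 P2 q"
      unfolding 1 2 3 using \<rho> ab by (intro share_log_add_le share_log_le; simp)+
  qed
  then show ?thesis
    unfolding fdma_uplink_def capacity_uplink_def
  proof (intro hull_mono UN_least subsetI)
    fix q \<rho> R
    assume "q \<in> feasible S" "\<rho> \<in> {0..1}"
      and "R \<in> {(R1, R2). 0 \<le> R1 \<and> R1 \<le> fdma_rate S P1 1 \<rho> q \<and>
        0 \<le> R2 \<and> R2 \<le> fdma_rate S P2 2 (1 - \<rho>) q}"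
    then show "R \<in> (\<Union>q\<in>feasible S. {(R1, R2). 0 \<le> R1 \<and> R1 \<le> user_rate S P1 1 q \<and>
        0 \<le> R2 \<and> R2 \<le> user_rate S P2 2 q \<and> R1 + R2 \<le> sum_rate S P1 P2 q})"
      using bounds[of \<rho> q] by (intro UN_I[of q]) auto
  qed
qed

section \<open>Bounding channel gains by the outer function\<close>

lemma user_dist_sq_pos: "0 < height S \<Longrightarrow> 0 < user_dist_sq S k"
  by (simp add: user_dist_sq_def add_pos_nonneg)

lemma channel_gain_le:
  assumes "0 < num_ant S" "0 \<le> eta S"
  shows "channel_gain S k q \<le>
    (\<Sum>n=1..num_ant S. eta S / (user_dist_sq S k + (q n - user_x S k)\<^sup>2))"
proof -
  define r where "r n = user_dist_sq S k + (user_x S k - q n)\<^sup>2" for n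
  have r: "0 \<le> r n" for n
    by (simp add: r_def user_dist_sq_def)
  define h where "h n = complex_of_real (sqrt (eta S)) *
       exp (- \<i> * complex_of_real (wave_num S * sqrt (r n))) / complex_of_real (sqrt (r n))
       * exp (- \<i> * complex_of_real (2 * pi * \<bar>q n - feed_pos S\<bar> / guide_len S))" for n
  \<comment> \<open>Both exponentials are pure phases of modulus 1. If \<open>r n = 0\<close>, both
    sides are 0 by the convention on division.\<close>
  have h: "cmod (h n) = sqrt (eta S) / sqrt (r n)" for n
    using assms r[of n] unfolding h_def norm_mult norm_divide norm_exp_eq_Re
    by simp
  have "channel_gain S k q = (cmod (\<Sum>n=1..num_ant S. h n))\<^sup>2 / num_ant S"
    by (simp add: channel_gain_def channel_def h_def r_def norm_mult norm_divide
        power_mult_distrib power_divide)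
  also have "\<dots> \<le> (\<Sum>n=1..num_ant S. cmod (h n))\<^sup>2 / num_ant S"
    by (intro divide_right_mono power_mono norm_sum) auto
  \<comment> \<open>Cauchy--Schwarz costs a factor \<open>num_ant S\<close>, which the squared
    normalisation \<open>1 / sqrt N\<close> of the channel cancels.\<close>
  also have "\<dots> \<le> (\<Sum>n=1..num_ant S. (cmod (h n))\<^sup>2)"
    using sum_squared_le_sum_of_squares[of "\<lambda>n. cmod (h n)" "{1..num_ant S}"] assms
    by (simp add: divide_simps)
  also have "\<dots> = (\<Sum>n=1..num_ant S. eta S / (user_dist_sq S k + (q n - user_x S k)\<^sup>2))"
    using assms r unfolding h by (simp add: power_divide) (simp add: r_def power2_commute)
  finally show ?thesis .
qed

lemma weighted_gain_le_sum_outer_fun: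
  assumes "0 < num_ant S" "0 \<le> eta S" "0 < noise_var S" "0 \<le> P1" "0 \<le> P2"
  shows "(P1 * channel_gain S 1 q + P2 * channel_gain S 2 q) / noise_var S
    \<le> (\<Sum>n=1..num_ant S. outer_fun S P1 P2 (q n))"
proof -
  have "(P1 * channel_gain S 1 q + P2 * channel_gain S 2 q) / noise_var S \<le>
    (P1 * (\<Sum>n=1..num_ant S. eta S / (user_dist_sq S 1 + (q n - user_x S 1)\<^sup>2)) +
     P2 * (\<Sum>n=1..num_ant S. eta S / (user_dist_sq S 2 + (q n - user_x S 2)\<^sup>2))) / noise_var S"
    using assms by (intro divide_right_mono add_mono mult_left_mono channel_gain_le) auto
  also have "\<dots> = (\<Sum>n=1..num_ant S. outer_fun S P1 P2 (q n))"
    by (simp add: outer_fun_def sum.distrib sum_distrib_left add_divide_distrib sum_divide_distrib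
        mult.commute)
  finally show ?thesis .
qed

section \<open>Maximum of the outer function and the sum-rate bound\<close>

lemma attains_max_at_critical_or_endpoint:
  fixes f :: "real \<Rightarrow> real"
  assumes "a \<le> b" and diff: "\<And>x. x \<in> {a..b} \<Longrightarrow> f differentiable at x"
  obtains m where "m \<in> {x \<in> {a..b}. deriv f x = 0} \<union> {a, b}" "\<And>x. x \<in> {a..b} \<Longrightarrow> f x \<le> f m"
proof -
  have "continuous_on {a..b} f"
    using diff by (meson continuous_at_imp_continuous_on differentiable_imp_continuous_within)
  then obtain m where m: "m \<in> {a..b}" "\<And>x. x \<in> {a..b} \<Longrightarrow> f x \<le> f m"
    using continuous_attains_sup[of "{a..b}" f] assms(1) by auto
  \<comment> \<open>Fermat's theorem; the radius chosen below keeps the neighbourhood of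
    \<open>m\<close> inside the interval.\<close>
  have "deriv f m = 0" if "a < m" "m < b"
  proof (rule DERIV_local_max)
    show "DERIV f m :> deriv f m"
      using diff[OF m(1)] by (simp add: DERIV_deriv_iff_real_differentiable)
    show "0 < min (m - a) (b - m)"
      using that by simp
    show "\<forall>y. \<bar>m - y\<bar> < min (m - a) (b - m) \<longrightarrow> f y \<le> f m"
      by (auto intro!: m(2) simp: abs_less_iff)
  qed
  then show thesis
    using m by (intro that[of m]) force+
qed

lemma outer_fun_differentiable:
  assumes "0 < height S"
  shows "outer_fun S P1 P2 differentiable at x"
proof -
  have "user_dist_sq S k + (x - user_x S k)\<^sup>2 \<noteq> 0" for k
    using user_dist_sq_pos[OF assms, of k] by (metis add_pos_nonneg less_irrefl zero_le_power2)
  then show ?thesis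
    unfolding outer_fun_def by (intro derivative_intros) auto
qed

text \<open>Each summand has a nonnegative numerator and a positive denominator growing with the
  distance to its user.\<close>

lemma outer_fun_le_of_closer:
  assumes "0 < height S" "0 \<le> eta S" "0 < noise_var S" "0 \<le> P1" "0 \<le> P2"
    and "\<bar>y - user_x S 1\<bar> \<le> \<bar>x - user_x S 1\<bar>" "\<bar>y - user_x S 2\<bar> \<le> \<bar>x - user_x S 2\<bar>"
  shows "outer_fun S P1 P2 x \<le> outer_fun S P1 P2 y"
  unfolding outer_fun_def using assms user_dist_sq_pos[OF assms(1)]
  by (intro add_mono divide_left_mono mult_pos_pos add_pos_nonneg) (auto simp: abs_le_square_iff)

lemma sum_rate_le_outer_sum_rate:
  assumes "0 < num_ant S" "0 < height S" "0 \<le> eta S" "0 < noise_var S" "0 \<le> P1" "0 \<le> P2"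
    and le: "user_x S 1 \<le> user_x S 2"
  shows "sum_rate S P1 P2 q \<le> outer_sum_rate S P1 P2"
proof -
  let ?f = "outer_fun S P1 P2" and ?X = "outer_crit S P1 P2 \<union> {user_x S 1, user_x S 2}"
  obtain m where m: "m \<in> ?X" and max: "\<And>x. x \<in> {user_x S 1..user_x S 2} \<Longrightarrow> ?f x \<le> ?f m"
    using attains_max_at_critical_or_endpoint[OF le outer_fun_differentiable[OF assms(2)]]
    unfolding outer_crit_def by blast
  have X: "?X \<subseteq> {user_x S 1..user_x S 2}"
    using le by (auto simp: outer_crit_def)
  \<comment> \<open>\<open>m\<close> is itself a candidate and all candidates lie between the users,
    so the greatest value exists and is \<open>?f m\<close>.\<close>
  have Greatest: "(GREATEST v. v \<in> ?f ` ?X) = ?f m"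
    using m max X by (intro Greatest_equality) blast+
  have glob: "?f x \<le> ?f m" for x
  proof -
    \<comment> \<open>Clamping \<open>x\<close> to the interval between the users brings it no
      farther from either of them.\<close>
    define y where "y = max (user_x S 1) (min x (user_x S 2))"
    have "?f x \<le> ?f y"
      using assms by (intro outer_fun_le_of_closer) (auto simp: y_def)
    also have "\<dots> \<le> ?f m"
      using le by (intro max) (auto simp: y_def)
    finally show ?thesis .
  qed
  let ?g = "(P1 * channel_gain S 1 q + P2 * channel_gain S 2 q) / noise_var S"
  have "?g \<le> (\<Sum>n=1..num_ant S. ?f (q n))"
    using assms by (intro weighted_gain_le_sum_outer_fun) auto
  also have "\<dots> \<le> num_ant S * ?f m"
    using sum_bounded_above[of "{1..num_ant S}" "\<lambda>n. ?f (q n)" "?f m"] glob by simp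
  finally have "?g \<le> num_ant S * ?f m" .
  \<comment> \<open>This makes the arguments of both logarithms positive, as monotonicity of
    \<open>log\<close> requires.\<close>
  moreover have "0 \<le> ?g"
    using assms by (simp add: channel_gain_nonneg)
  ultimately show ?thesis
    unfolding sum_rate_def outer_sum_rate_def Greatest by simp
qed

section \<open>Capacity region inside the outer bound\<close>

lemma user_rate_le_best:
  assumes "best_placement S k qs" "q \<in> feasible S" "0 \<le> Pk" "0 < noise_var S"
  shows "user_rate S Pk k q \<le> user_rate S Pk k qs"
proof -
  have "channel_gain S k q \<le> channel_gain S k qs"
    using assms by (auto simp: best_placement_def is_arg_max_linorder)
  then have "Pk * channel_gain S k q / noise_var S \<le> Pk * channel_gain S k qs / noise_var S"
    using assms by (intro divide_right_mono mult_left_mono) auto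
  moreover have "0 \<le> Pk * channel_gain S k q / noise_var S"
    using assms by (simp add: channel_gain_nonneg)
  ultimately show ?thesis
    unfolding user_rate_def by simp
qed

text \<open>A box cut by a half-plane. Convexity absorbs the hull in \<open>capacity_uplink\<close>,
  so the outer bound need only be checked for one placement at a time.\<close>

lemma convex_outer_uplink: "convex (outer_uplink S qs1 qs2 P1 P2)"
proof -
  have "outer_uplink S qs1 qs2 P1 P2 =
    {0..user_rate S P1 1 qs1} \<times> {0..user_rate S P2 2 qs2} \<inter>
    {R. (1, 1) \<bullet> R \<le> outer_sum_rate S P1 P2}"
    by (auto simp: outer_uplink_def)
  then show ?thesis
    by (simp add: convex_Int convex_Times convex_halfspace_le)
qed

lemma capacity_uplink_subset_outer_uplink:
  assumes "0 < num_ant S" "0 < height S" "0 \<le> eta S" "0 < noise_var S" "0 \<le> P1" "0 \<le> P2"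
    and "user_x S 1 \<le> user_x S 2"
    and best: "best_placement S 1 qs1" "best_placement S 2 qs2"
  shows "capacity_uplink S P1 P2 \<subseteq> outer_uplink S qs1 qs2 P1 P2"
  unfolding capacity_uplink_def
proof (intro hull_minimal convex_outer_uplink UN_least subsetI)
  fix q R
  assume q: "q \<in> feasible S"
    and R: "R \<in> {(R1, R2). 0 \<le> R1 \<and> R1 \<le> user_rate S P1 1 q \<and> 0 \<le> R2 \<and>
      R2 \<le> user_rate S P2 2 q \<and> R1 + R2 \<le> sum_rate S P1 P2 q}"
  show "R \<in> outer_uplink S qs1 qs2 P1 P2"
    using R user_rate_le_best[OF best(1) q, of P1] user_rate_le_best[OF best(2) q, of P2]
      sum_rate_le_outer_sum_rate[of S P1 P2 q] assms
    by (auto simp: outer_uplink_def)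
qed

theorem mainTheorem8:
  fixes S :: pinching_system and P :: real and qs1 qs2 :: "nat \<Rightarrow> real"
  assumes "num_ant S > 1"
    and "eta S > 0" and "noise_var S > 0" and "height S > 0" and "wave_num S > 0"
    and "guide_len S > 0" and "spacing S > 0" and "P > 0"
    and "user_x S 1 \<le> user_x S 2"
    and "{user_x S 1..user_x S 2} \<subseteq> {feed_pos S..end_pos S}"
    and "feasible S \<noteq> {}"
    and "best_placement S 1 qs1" and "best_placement S 2 qs2"
  shows "downlink (tdma_uplink S qs1 qs2) P \<subseteq> downlink (fdma_uplink S) P
    \<and> downlink (fdma_uplink S) P \<subseteq> downlink (capacity_uplink S) P
    \<and> downlink (capacity_uplink S) P \<subseteq> downlink (outer_uplink S qs1 qs2) P"
proof (intro conjI downlink_mono)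
  fix P1 P2 :: real assume P: "0 \<le> P1" "0 \<le> P2"
  \<comment> \<open>Feasibility of \<open>qs1\<close> and \<open>qs2\<close> is part of being a
    maximiser over \<open>feasible S\<close>.\<close>
  show "tdma_uplink S qs1 qs2 P1 P2 \<subseteq> fdma_uplink S P1 P2"
    using assms P by (intro tdma_uplink_subset_fdma_uplink)
      (auto simp: best_placement_def is_arg_max_def)
  show "fdma_uplink S P1 P2 \<subseteq> capacity_uplink S P1 P2"
    using assms P by (intro fdma_uplink_subset_capacity_uplink)
  show "capacity_uplink S P1 P2 \<subseteq> outer_uplink S qs1 qs2 P1 P2"
    using assms P by (intro capacity_uplink_subset_outer_uplink) auto
qed

end
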